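(* Let $A=(a_{ij})$, $B=(b_{ij})$ and $X=(x_{ij})$, $i,j=0,1,2,3,\dots$, be the infinite matrices with entries in $\mathbb{Z}[[q]]$ defined by $$a_{ij}=q^{(4i+1)(4j+1)}\quad (i,j\ge 0),$$ $$b_{ij}=\begin{cases}-q^{(4i-1)(4j-1)} & \text{if } i,j>0,\\ \sum_{n=0}^{\infty}q^{(2n+1)^2} & \text{if } i=j=0,\\ 0 & \text{otherwise,}\end{cases}$$ $$x_{ij}=\begin{cases}-\dfrac{q^{12(j-i-1)+4}}{1-q^{16(j-i-1)+8}} & \text{if } j>i,\\[2mm] \dfrac{q^{4(i-j)}}{1-q^{16(i-j)+8}} & \text{if } 1\le j\le i,\\[2mm] \dfrac{(q^8;q^{16})_i}{(q^{16};q^{16})_i}\,q^{4i} & \text{if } j=0.\end{cases}$$ Then $XB=AX$.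
   Context: Notation: $(a;q)_0=1$ and $(a;q)_n=(1-a)(1-aq)\cdots(1-aq^{n-1})$ for $n\ge1$; thus $(q^8;q^{16})_i=\prod_{m=0}^{i-1}(1-q^{8+16m})$ and $(q^{16};q^{16})_i=\prod_{m=1}^{i}(1-q^{16m})$. All matrices are infinite, indexed by $i,j\in\{0,1,2,\dots\}$, with entries formal power series in $q$, fractions being expanded as power series in $q$. Matrix products are given by $(MN)_{ij}=\sum_{m\ge 0}M_{im}N_{mj}$; for $XB$ and $AX$ these infinite sums converge in the $q$-adic topology on $\mathbb{Z}[[q]]$ (that is, for each exponent of $q$ only finitely many terms contribute). *)

theory Defs
  imports "HOL-Computational_Algebra.Formal_Power_Series"
begin

type_synonym qseries = "int fps"

abbreviation q :: qseries where
  "q \<equiv> fps_X"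

text \<open>
  Quotients in \<open>\<int>[[q]]\<close> by a series with constant term 1; the library's division on
  formal power series needs an inverse operation on the coefficients and is not available
  over \<^typ>\<open>int\<close>.
\<close>
definition qfrac :: "qseries \<Rightarrow> qseries \<Rightarrow> qseries" where
  "qfrac f g = f * fps_right_inverse g 1"

lemma qfrac_mult_cancel:
  assumes "fps_nth g 0 = 1"
  shows "qfrac f g * g = f"
proof -
  have "g * fps_right_inverse g 1 = 1"
    by (rule fps_right_inverse) (simp add: assms)
  then show ?thesis
    unfolding qfrac_def by (metis mult.assoc mult.commute mult.right_neutral)
qed

definition qpoch :: "'a::comm_ring_1 \<Rightarrow> 'a \<Rightarrow> nat \<Rightarrow> 'a" where
  "qpoch a p n = (\<Prod>k<n. 1 - a * p ^ k)"

type_synonym qmatrix = "nat \<Rightarrow> nat \<Rightarrow> qseries"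

text \<open>
  The topology on formal power series is the \<open>q\<close>-adic one, so \<open>suminf\<close> below is the
  \<open>q\<close>-adic sum. Convergence of every infinite sum used is proved at the end of the theory.
\<close>
definition matmul :: "qmatrix \<Rightarrow> qmatrix \<Rightarrow> qmatrix" where
  "matmul M N = (\<lambda>i j. \<Sum>m. M i m * N m j)"

definition matA :: qmatrix where
  "matA i j = q ^ ((4 * i + 1) * (4 * j + 1))"

definition matB :: qmatrix where
  "matB i j =
     (if i > 0 \<and> j > 0 then - (q ^ ((4 * i - 1) * (4 * j - 1)))
      else if i = 0 \<and> j = 0 then (\<Sum>n. q ^ ((2 * n + 1)\<^sup>2))
      else 0)"

definition matX :: qmatrix where
  "matX i j =
     (if j > i then
        - qfrac (q ^ (12 * (j - i - 1) + 4)) (1 - q ^ (16 * (j - i - 1) + 8))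
      else if 1 \<le> j then
        qfrac (q ^ (4 * (i - j))) (1 - q ^ (16 * (i - j) + 8))
      else
        qfrac (qpoch (q ^ 8) (q ^ 16) i) (qpoch (q ^ 16) (q ^ 16) i) * q ^ (4 * i))"

lemma qpoch_nth_0: "fps_nth (qpoch (q ^ 16) (q ^ 16) n) 0 = 1"
  by (induction n) (simp_all add: qpoch_def)

lemma summable_fpsI:
  fixes f :: "nat \<Rightarrow> 'a::comm_ring_1 fps"
  assumes "\<And>m k. k < m \<Longrightarrow> fps_nth (f m) k = 0"
  shows "summable f"
proof -
  have "f sums Abs_fps (\<lambda>k. \<Sum>m\<le>k. fps_nth (f m) k)"
    unfolding sums_def
  proof (rule tendsto_fpsI)
    fix n
    have "fps_nth (\<Sum>m<N. f m) n = (\<Sum>m\<le>n. fps_nth (f m) n)" if "N > n" for N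
      unfolding fps_sum_nth using that assms
      by (intro sum.mono_neutral_right) auto
    then show "\<forall>\<^sub>F N in sequentially.
        fps_nth (\<Sum>m<N. f m) n = fps_nth (Abs_fps (\<lambda>k. \<Sum>m\<le>k. fps_nth (f m) k)) n"
      by (auto intro: eventually_mono[OF eventually_gt_at_top[of n]])
  qed
  then show ?thesis
    by (rule sums_summable)
qed

lemma summable_matB_00: "summable (\<lambda>n. q ^ ((2 * n + 1)\<^sup>2))"
proof (rule summable_fpsI)
  fix m k :: nat
  assume "k < m"
  moreover have "m \<le> (2 * m + 1)\<^sup>2"
    by (simp add: power2_eq_square)
  ultimately show "fps_nth (q ^ ((2 * m + 1)\<^sup>2)) k = 0"
    by simp
qed

lemma matB_nth_eq_0:
  assumes "k < m"
  shows "fps_nth (matB m j) k = 0"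
proof (cases "j > 0")
  case True
  have "m \<le> (4 * m - 1) * 1"
    using assms by simp
  also have "\<dots> \<le> (4 * m - 1) * (4 * j - 1)"
    using True by (intro mult_le_mono2) simp
  finally show ?thesis
    using assms True by (simp add: matB_def)
qed (use assms in \<open>simp add: matB_def\<close>)

lemma summable_XB: "summable (\<lambda>m. matX i m * matB m j)"
  by (rule summable_fpsI) (auto simp: fps_mult_nth matB_nth_eq_0 intro!: sum.neutral)

lemma summable_AX: "summable (\<lambda>m. matA i m * matX m j)"
proof (rule summable_fpsI)
  fix m k :: nat
  assume "k < m"
  then show "fps_nth (matA i m * matX m j) k = 0"
    unfolding matA_def fps_X_power_mult_nth by simp
qed

end

theory Submission
  imports Defs
begin

text \<open>
  Write \<open>Q = q\<^sup>8\<close>. For \<open>j > 0\<close>, both \<open>(XB)\<^sub>i\<^sub>j\<close> and \<open>(AX)\<^sub>i\<^sub>j\<close> split into a finite sum and a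
  Lambert series; up to a common monomial the latter is
  \<open>U\<^sub>j = \<Sum>\<^sub>d Q\<^bsup>d(2j+1)+j\<^esup> / (1 - Q\<^bsup>2d+1\<^esup>)\<close>, respectively \<open>U\<^sub>i\<close>. Since \<open>U\<^sub>j - U\<^bsub>j+1\<^esub>\<close> is
  \<open>Q\<^sup>j\<close> times a geometric series in \<open>Q\<^bsup>2j+1\<^esup>\<close>, the difference \<open>U\<^sub>j - U\<^sub>i\<close> is a finite sum of terms
  \<open>Q\<^sup>d / (1 - Q\<^bsup>2d+1\<^esup>)\<close>. Splitting these terms off the finite sums leaves a polynomial double sum,
  which is symmetric in \<open>i\<close> and \<open>j\<close>.

  For \<open>j = 0\<close>, put \<open>r\<^sub>n = (Q;Q\<^sup>2)\<^sub>n / (Q\<^sup>2;Q\<^sup>2)\<^sub>n\<close> and \<open>G\<^sub>i = \<Sum>\<^sub>m r\<^sub>m Q\<^bsup>(2i+1)m\<^esup>\<close>; the claim becomes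
  \<open>r\<^sub>i b\<^sub>0\<^sub>0 = q G\<^sub>i\<close>. Both sides satisfy \<open>(1 - Q\<^bsup>2i+1\<^esup>) y\<^sub>i = (1 - Q\<^bsup>2i+2\<^esup>) y\<^bsub>i+1\<^esub>\<close>, so their
  difference at \<open>i\<close> is a multiple of their difference at any \<open>n \<ge> i\<close>, and the latter is divisible
  by \<open>q\<^sup>n\<close> by Shanks' finite form of Gauss's identity.
\<close>

section \<open>Adic sums\<close>

text \<open>Convergence with a prescribed rate: the tail after \<open>N\<close> terms is divisible
  by \<open>q ^ N\<close>. This turns identities between infinite sums into divisibility statements
  about truncated sums.\<close>

definition adic_sums :: "(nat \<Rightarrow> qseries) \<Rightarrow> qseries \<Rightarrow> bool" where
  "adic_sums f s \<longleftrightarrow> (\<forall>N. q ^ N dvd s - (\<Sum>m<N. f m))"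

lemma X_power_dvd_iff:
  fixes f :: "'a::comm_ring_1 fps"
  shows "fps_X ^ n dvd f \<longleftrightarrow> (\<forall>k<n. fps_nth f k = 0)"
proof
  assume "fps_X ^ n dvd f"
  then show "\<forall>k<n. fps_nth f k = 0"
    by (auto simp: dvd_def fps_X_power_mult_nth)
next
  assume "\<forall>k<n. fps_nth f k = 0"
  then have "f = fps_X ^ n * fps_shift n f"
    by (intro fps_ext) (auto simp: fps_X_power_mult_nth)
  then show "fps_X ^ n dvd f"
    by (metis dvd_triv_left)
qed

lemma eq_0_if_X_powers_dvd:
  fixes f :: "'a::comm_ring_1 fps"
  assumes "\<And>n. fps_X ^ n dvd f"
  shows "f = 0"
  using assms unfolding X_power_dvd_iff by (intro fps_ext) (metis fps_zero_nth lessI)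

lemma adic_sums_imp_suminf:
  assumes "adic_sums f s"
  shows "suminf f = s"
proof -
  have "f sums s"
    unfolding sums_def
  proof (rule tendsto_fpsI)
    fix n
    have "fps_nth (\<Sum>m<N. f m) n = fps_nth s n" if "N > n" for N
    proof -
      have "q ^ N dvd s - (\<Sum>m<N. f m)"
        using assms unfolding adic_sums_def by blast
      then show ?thesis
        using that unfolding X_power_dvd_iff by fastforce
    qed
    then show "\<forall>\<^sub>F N in sequentially. fps_nth (\<Sum>m<N. f m) n = fps_nth s n"
      by (auto intro: eventually_mono[OF eventually_gt_at_top[of n]])
  qed
  then show ?thesis
    by (rule sums_unique[symmetric])
qed

lemma adic_sums_suminf:
  assumes "\<And>m. q ^ m dvd f m"
  shows "adic_sums f (suminf f)"
proof -
  define s where "s = Abs_fps (\<lambda>k. \<Sum>m\<le>k. fps_nth (f m) k)"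
  have "adic_sums f s"
    unfolding adic_sums_def X_power_dvd_iff
  proof (intro allI impI)
    fix N k :: nat
    assume "k < N"
    then have "(\<Sum>m<N. fps_nth (f m) k) = (\<Sum>m\<le>k. fps_nth (f m) k)"
      using assms unfolding X_power_dvd_iff
      by (intro sum.mono_neutral_right) auto
    then show "fps_nth (s - (\<Sum>m<N. f m)) k = 0"
      by (simp add: s_def fps_sum_nth)
  qed
  then show ?thesis
    using adic_sums_imp_suminf by metis
qed

lemma adic_sums_mult: "adic_sums f s \<Longrightarrow> adic_sums (\<lambda>m. c * f m) (c * s)"
  by (simp add: adic_sums_def sum_distrib_left[symmetric] right_diff_distrib[symmetric])

lemma adic_sums_diff:
  assumes "adic_sums f s" "adic_sums g t"
  shows "adic_sums (\<lambda>m. f m - g m) (s - t)"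
proof -
  have "s - t - (\<Sum>m<N. f m - g m) = (s - (\<Sum>m<N. f m)) - (t - (\<Sum>m<N. g m))" for N
    by (simp add: sum_subtractf)
  then show ?thesis
    using assms unfolding adic_sums_def by (metis dvd_diff)
qed

text \<open>The shifted series alone controls the error after \<open>N + i\<close> terms only modulo
  \<open>q ^ N\<close>. The divisibility of the terms restores the full rate, because the sum is
  unique.\<close>

lemma adic_sums_unshift:
  assumes "\<And>m. q ^ m dvd f m" and "adic_sums (\<lambda>m. f (m + i)) s"
  shows "adic_sums f ((\<Sum>m<i. f m) + s)"
proof -
  have "adic_sums (\<lambda>m. f (m + i)) (suminf f - (\<Sum>m<i. f m))"
    unfolding adic_sums_def
  proof
    fix N
    have "(\<Sum>m<N + i. f m) = (\<Sum>m<i. f m) + (\<Sum>m<N. f (m + i))"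
      by (induction N) simp_all
    moreover have "q ^ (N + i) dvd suminf f - (\<Sum>m<N + i. f m)"
      using adic_sums_suminf[OF assms(1)] unfolding adic_sums_def by blast
    ultimately have "q ^ (N + i) dvd suminf f - (\<Sum>m<i. f m) - (\<Sum>m<N. f (m + i))"
      by (simp add: algebra_simps)
    then show "q ^ N dvd suminf f - (\<Sum>m<i. f m) - (\<Sum>m<N. f (m + i))"
      by (rule power_le_dvd) simp
  qed
  then have "suminf f = (\<Sum>m<i. f m) + s"
    using adic_sums_imp_suminf[OF assms(2)] adic_sums_imp_suminf by fastforce
  then show ?thesis
    using adic_sums_suminf[OF assms(1)] by simp
qed

section \<open>The columns \<open>j > 0\<close>\<close>

abbreviation Q :: qseries where
  "Q \<equiv> q ^ 8"

section \<open>The Lambert series \<open>U\<close> and its telescoping\<close>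

definition w :: "nat \<Rightarrow> qseries" where
  "w d = qfrac 1 (1 - Q ^ (2 * d + 1))"

lemma w_mult: "w d * (1 - Q ^ (2 * d + 1)) = 1"
  unfolding w_def by (rule qfrac_mult_cancel) (simp flip: power_mult)

lemma qfrac_w: "qfrac f (1 - q ^ (16 * d + 8)) = f * w d"
proof -
  have "q ^ (16 * d + 8) = Q ^ (2 * d + 1)"
    by (simp flip: power_mult power_add)
  then show ?thesis
    by (simp add: w_def qfrac_def)
qed

definition U :: "nat \<Rightarrow> qseries" where
  "U j = (\<Sum>d. Q ^ (d * (2 * j + 1) + j) * w d)"

lemma X_power_dvd_Q_power: "n \<le> m \<Longrightarrow> q ^ n dvd Q ^ m"
  unfolding power_mult[symmetric] by (rule le_imp_power_dvd) simp

lemma adic_sums_U: "adic_sums (\<lambda>d. Q ^ (d * (2 * j + 1) + j) * w d) (U j)"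
  unfolding U_def by (rule adic_sums_suminf) (intro dvd_mult2 X_power_dvd_Q_power, simp)

lemma U_step: "U j = Q ^ j * w j + U (Suc j)"
proof -
  have "adic_sums (\<lambda>d. Q ^ (d * (2 * j + 1) + j) * w d - Q ^ (d * (2 * Suc j + 1) + Suc j) * w d)
    (U j - U (Suc j))"
    by (intro adic_sums_diff adic_sums_U)
  moreover have "Q ^ (d * (2 * j + 1) + j) * w d - Q ^ (d * (2 * Suc j + 1) + Suc j) * w d
     = Q ^ j * (Q ^ (2 * j + 1)) ^ d" for d
  proof -
    \<comment> \<open>Passing from \<open>j\<close> to \<open>Suc j\<close> multiplies the
      \<open>d\<close>-th term by \<open>Q ^ (2 * d + 1)\<close>, so the difference of the two terms
      cancels the denominator in \<open>w d\<close>.\<close>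
    have "Q ^ (d * (2 * Suc j + 1) + Suc j) = Q ^ (d * (2 * j + 1) + j) * Q ^ (2 * d + 1)"
      unfolding power_add[symmetric] by (rule arg_cong[of _ _ "power Q"]) (simp add: algebra_simps)
    then have "Q ^ (d * (2 * j + 1) + j) * w d - Q ^ (d * (2 * Suc j + 1) + Suc j) * w d
      = Q ^ (d * (2 * j + 1) + j) * (w d * (1 - Q ^ (2 * d + 1)))"
      by (simp add: algebra_simps)
    also have "\<dots> = Q ^ (j + (2 * j + 1) * d)"
      by (simp only: w_mult mult_1_right) (simp add: algebra_simps)
    finally show ?thesis
      unfolding power_mult[of _ "2 * j + 1" d, symmetric] power_add[symmetric] .
  qed
  ultimately have "adic_sums (\<lambda>d. Q ^ j * (Q ^ (2 * j + 1)) ^ d) (U j - U (Suc j))"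
    by simp
  moreover have "adic_sums (\<lambda>d. Q ^ j * (Q ^ (2 * j + 1)) ^ d) (Q ^ j * w j)"
    unfolding adic_sums_def
  proof
    fix N
    define y where "y = Q ^ (2 * j + 1)"
    have "w j * y ^ N = w j * (1 - (1 - y) * (\<Sum>d<N. y ^ d))"
      by (simp add: one_diff_power_eq[symmetric])
    also have "\<dots> = w j - (w j * (1 - y)) * (\<Sum>d<N. y ^ d)"
      by (simp add: algebra_simps)
    also have "w j * (1 - y) = 1"
      unfolding y_def by (rule w_mult)
    finally have "Q ^ j * w j - (\<Sum>d<N. Q ^ j * y ^ d) = Q ^ j * (w j * y ^ N)"
      by (simp only: sum_distrib_left[symmetric] mult_1_left right_diff_distrib)
    moreover have "q ^ N dvd y ^ N"
      unfolding y_def power_mult[symmetric] by (rule le_imp_power_dvd) simp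
    ultimately show "q ^ N dvd Q ^ j * w j - (\<Sum>d<N. Q ^ j * (Q ^ (2 * j + 1)) ^ d)"
      unfolding y_def by simp
  qed
  ultimately have "U j - U (Suc j) = Q ^ j * w j"
    using adic_sums_imp_suminf by metis
  then show ?thesis
    by (simp add: algebra_simps)
qed

lemma U_0: "U 0 = (\<Sum>d<j. Q ^ d * w d) + U j"
proof (induction j)
  case (Suc j)
  then show ?case
    using U_step[of j] by (simp add: add.assoc)
qed simp

section \<open>The finite sums and their symmetry\<close>

lemma finite_part_summand:
  assumes "d < i"
  shows "(Q ^ (d + j * (2 * (i - d) - 1)) - Q ^ (2 * i * j + d)) * w d
    = (\<Sum>e<j. Q ^ (2 * i * j - (2 * d * e + d + e + 1)))"
proof -
  define y where "y = Q ^ (2 * d + 1)"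
  obtain c where i: "i = d + Suc c"
    using assms less_imp_add_positive by (metis Suc_pred add.commute)
  \<comment> \<open>The two exponents differ by \<open>j * (2 * d + 1)\<close>, so the factor
    \<open>w d\<close> leaves a geometric polynomial in \<open>y\<close>.\<close>
  have "Q ^ (2 * i * j + d) = Q ^ (d + j * (2 * (i - d) - 1)) * y ^ j"
    unfolding y_def power_mult[symmetric] power_add[symmetric] i
    by (rule arg_cong[of _ _ "power q"]) (simp add: algebra_simps)
  then have "(Q ^ (d + j * (2 * (i - d) - 1)) - Q ^ (2 * i * j + d)) * w d
     = Q ^ (d + j * (2 * (i - d) - 1)) * ((1 - y ^ j) * w d)"
    by (simp add: algebra_simps)
  also have "(1 - y ^ j) * w d = (w d * (1 - y)) * (\<Sum>e<j. y ^ e)"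
    by (simp add: one_diff_power_eq algebra_simps)
  also have "w d * (1 - y) = 1"
    unfolding y_def by (rule w_mult)
  \<comment> \<open>Reversing the summation makes the final exponents symmetric under exchanging
    \<open>(d, i)\<close> with \<open>(e, j)\<close>.\<close>
  also have "(\<Sum>e<j. y ^ e) = (\<Sum>e<j. y ^ (j - Suc e))"
    by (rule sum.nat_diff_reindex[symmetric])
  also have "Q ^ (d + j * (2 * (i - d) - 1)) * (1 * (\<Sum>e<j. y ^ (j - Suc e)))
    = (\<Sum>e<j. Q ^ (d + j * (2 * (i - d) - 1)) * y ^ (j - Suc e))"
    by (simp add: sum_distrib_left)
  also have "\<dots> = (\<Sum>e<j. Q ^ (2 * i * j - (2 * d * e + d + e + 1)))"
  proof (rule sum.cong[OF refl])
    fix e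
    assume "e \<in> {..<j}"
    then obtain b where j: "j = e + Suc b"
      using less_imp_add_positive by (metis Suc_pred add.commute lessThan_iff)
    have "d + j * (2 * (i - d) - 1) + (2 * d + 1) * (j - Suc e) = 2 * i * j - (2 * d * e + d + e + 1)"
      unfolding i j by (simp add: algebra_simps)
    then show "Q ^ (d + j * (2 * (i - d) - 1)) * y ^ (j - Suc e)
      = Q ^ (2 * i * j - (2 * d * e + d + e + 1))"
      unfolding y_def power_mult[of Q, symmetric] power_add[symmetric] by simp
  qed
  finally show ?thesis .
qed

text \<open>Up to the factor \<open>- q ^ (4 * j + 1)\<close>, these are the terms
  \<open>m = i - d\<close> of \<open>XB\<close>, after scaling by \<open>q ^ (4 * i)\<close>. With
  \<open>i\<close> and \<open>j\<close> exchanged they are the terms \<open>m = j - Suc d\<close> of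
  \<open>AX\<close>.\<close>

definition finite_part :: "nat \<Rightarrow> nat \<Rightarrow> qseries" where
  "finite_part i j = (\<Sum>d<i. Q ^ (d + j * (2 * (i - d) - 1)) * w d)"

lemma finite_part_eq:
  "finite_part i j = (\<Sum>d<i. \<Sum>e<j. Q ^ (2 * i * j - (2 * d * e + d + e + 1)))
    + Q ^ (2 * i * j) * (\<Sum>d<i. Q ^ d * w d)"
proof -
  have "Q ^ (d + j * (2 * (i - d) - 1)) * w d
      = (\<Sum>e<j. Q ^ (2 * i * j - (2 * d * e + d + e + 1))) + Q ^ (2 * i * j) * (Q ^ d * w d)"
    if "d < i" for d
    using finite_part_summand[OF that, of j]
    by (simp only: left_diff_distrib power_add[of Q "2 * i * j" d] diff_eq_eq
        mult.assoc[of "Q ^ (2 * i * j)"])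
  then show ?thesis
    unfolding finite_part_def by (simp add: sum.distrib sum_distrib_left)
qed

text \<open>By \<open>U_0\<close>, the left side is \<open>Q ^ (2 * i * j)\<close> times
  \<open>U 0\<close> less the sums of \<open>Q ^ d * w d\<close> over \<open>d < i\<close> and over
  \<open>d < j\<close>, minus the symmetric double sum. This is invariant under exchanging
  \<open>i\<close> and \<open>j\<close>.\<close>

lemma finite_part_commute:
  "Q ^ (2 * i * j) * U j - finite_part i j = Q ^ (2 * i * j) * U i - finite_part j i"
proof -
  have "(\<Sum>d<i. \<Sum>e<j. Q ^ (2 * i * j - (2 * d * e + d + e + 1)))
      = (\<Sum>d<j. \<Sum>e<i. Q ^ (2 * j * i - (2 * d * e + d + e + 1)))"
    by (subst sum.swap) (simp add: mult_ac add_ac)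
  moreover have "Q ^ (2 * i * j) * ((\<Sum>d<j. Q ^ d * w d) + U j)
      = Q ^ (2 * i * j) * ((\<Sum>d<i. Q ^ d * w d) + U i)"
    unfolding U_0[symmetric] ..
  ultimately show ?thesis
    unfolding finite_part_eq by (simp add: algebra_simps)
qed

section \<open>Both products in a column \<open>j > 0\<close>\<close>

text \<open>The factor \<open>q ^ (4 * i)\<close> avoids the negative exponent in \<open>q\<close> to the power \<open>4j + 1 - 4i\<close>.\<close>
lemma XB_pos:
  assumes "j > 0"
  shows "q ^ (4 * i) * matmul matX matB i j
    = q ^ (4 * j + 1) * (Q ^ (2 * i * j) * U j - finite_part i j)"
proof -
  define f where "f m = q ^ (4 * i) * (matX i m * matB m j)" for m
  have dvd: "q ^ m dvd matX i m * matB m j" for m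
    by (intro dvd_mult) (simp add: X_power_dvd_iff matB_nth_eq_0)
  then have f_dvd: "q ^ m dvd f m" for m
    by (simp add: f_def dvd_mult)
  \<comment> \<open>Row 0 of \<open>matB\<close> vanishes off the diagonal, so the exceptional entry
    \<open>matX i 0\<close> does not contribute.\<close>
  have f0: "f 0 = 0"
    using assms by (simp add: f_def matB_def)
  obtain j' where j: "j = Suc j'"
    using assms gr0_conv_Suc by auto
  have fin: "f (i - d) = - (q ^ (4 * j + 1) * (Q ^ (d + j * (2 * (i - d) - 1)) * w d))"
    if d: "d < i" for d
  proof -
    obtain c where i: "i = d + Suc c"
      using d less_imp_add_positive by (metis Suc_pred add.commute)
    have "4 * i + (4 * d + (4 * Suc c - 1) * (4 * j - 1))
      = 4 * j + 1 + 8 * (d + j * (2 * (i - d) - 1))"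
      unfolding i j by (simp add: algebra_simps)
    then have "q ^ (4 * i) * (q ^ (4 * d) * q ^ ((4 * Suc c - 1) * (4 * j - 1)))
      = q ^ (4 * j + 1) * Q ^ (d + j * (2 * (i - d) - 1))"
      by (simp only: power_mult[of q 8, symmetric] power_add[symmetric])
    moreover have "f (i - d)
      = - (q ^ (4 * i) * (q ^ (4 * d) * q ^ ((4 * Suc c - 1) * (4 * j - 1))) * w d)"
      using assms by (simp add: f_def matX_def matB_def qfrac_w i)
    ultimately show ?thesis
      by (simp only: mult.assoc)
  qed
  \<comment> \<open>Strictly above the diagonal of \<open>matX\<close> the terms form the Lambert
    series; the diagonal entry belongs to the finite part.\<close>
  have inf: "f (d + Suc i) = q ^ (4 * j + 1) * Q ^ (2 * i * j) * (Q ^ (d * (2 * j + 1) + j) * w d)"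
    for d
  proof -
    have "4 * i + (12 * d + 4 + (4 * (d + Suc i) - 1) * (4 * j - 1))
      = 4 * j + 1 + 8 * (2 * i * j) + 8 * (d * (2 * j + 1) + j)"
      unfolding j by (simp add: algebra_simps)
    then have "q ^ (4 * i) * (q ^ (12 * d + 4) * q ^ ((4 * (d + Suc i) - 1) * (4 * j - 1)))
      = q ^ (4 * j + 1) * Q ^ (2 * i * j) * Q ^ (d * (2 * j + 1) + j)"
      by (simp only: power_mult[of q 8, symmetric] power_add[symmetric])
    moreover have "f (d + Suc i)
      = q ^ (4 * i) * (q ^ (12 * d + 4) * q ^ ((4 * (d + Suc i) - 1) * (4 * j - 1))) * w d"
      using assms by (simp add: f_def matX_def matB_def qfrac_w)
    ultimately show ?thesis
      by (simp only: mult.assoc)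
  qed
  have "adic_sums f ((\<Sum>m<Suc i. f m) + q ^ (4 * j + 1) * Q ^ (2 * i * j) * U j)"
    by (rule adic_sums_unshift[OF f_dvd], unfold inf) (intro adic_sums_mult adic_sums_U)
  moreover have "adic_sums f (q ^ (4 * i) * matmul matX matB i j)"
    unfolding f_def matmul_def
    by (intro adic_sums_mult adic_sums_suminf dvd)
  ultimately have "q ^ (4 * i) * matmul matX matB i j
      = (\<Sum>m<Suc i. f m) + q ^ (4 * j + 1) * Q ^ (2 * i * j) * U j"
    using adic_sums_imp_suminf by metis
  also have "(\<Sum>m<Suc i. f m) = (\<Sum>m<i. f (Suc m))"
    by (simp add: sum.lessThan_Suc_shift f0 del: sum.lessThan_Suc)
  also have "\<dots> = (\<Sum>d<i. f (i - d))"
    by (subst sum.nat_diff_reindex[symmetric]) (simp add: Suc_diff_Suc)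
  also have "\<dots> = - (q ^ (4 * j + 1) * finite_part i j)"
    unfolding finite_part_def sum_distrib_left sum_negf[symmetric]
    by (intro sum.cong refl fin) simp
  finally show ?thesis
    by (simp add: algebra_simps)
qed

text \<open>The sum now runs down a column of \<open>matX\<close>, so the roles are exchanged:
  entries strictly above the diagonal give the finite part, and the diagonal term starts the Lambert
  series.\<close>

lemma AX_pos:
  assumes "j > 0"
  shows "q ^ (4 * i) * matmul matA matX i j
    = q ^ (4 * j + 1) * (Q ^ (2 * i * j) * U i - finite_part j i)"
proof -
  define f where "f m = q ^ (4 * i) * (matA i m * matX m j)" for m
  have dvd: "q ^ m dvd matA i m * matX m j" for m
    unfolding matA_def by (intro dvd_mult2 le_imp_power_dvd) simp
  then have f_dvd: "q ^ m dvd f m" for m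
    by (simp add: f_def dvd_mult)
  have fin: "f (j - Suc d) = - (q ^ (4 * j + 1) * (Q ^ (d + i * (2 * (j - d) - 1)) * w d))"
    if d: "d < j" for d
  proof -
    obtain c where j: "j = d + Suc c"
      using d less_imp_add_positive by (metis Suc_pred add.commute)
    have "4 * i + ((4 * i + 1) * (4 * c + 1) + (12 * d + 4))
      = 4 * j + 1 + 8 * (d + i * (2 * (j - d) - 1))"
      unfolding j by (simp add: algebra_simps)
    then have "q ^ (4 * i) * (q ^ ((4 * i + 1) * (4 * c + 1)) * q ^ (12 * d + 4))
      = q ^ (4 * j + 1) * Q ^ (d + i * (2 * (j - d) - 1))"
      by (simp only: power_mult[of q 8, symmetric] power_add[symmetric])
    moreover have "f (j - Suc d)
      = - (q ^ (4 * i) * (q ^ ((4 * i + 1) * (4 * c + 1)) * q ^ (12 * d + 4)) * w d)"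
      by (simp add: f_def matX_def matA_def qfrac_w j)
    ultimately show ?thesis
      by (simp only: mult.assoc)
  qed
  have inf: "f (d + j) = q ^ (4 * j + 1) * Q ^ (2 * i * j) * (Q ^ (d * (2 * i + 1) + i) * w d)"
    for d
  proof -
    have "4 * i + ((4 * i + 1) * (4 * (d + j) + 1) + 4 * d)
      = 4 * j + 1 + 8 * (2 * i * j) + 8 * (d * (2 * i + 1) + i)"
      by (simp add: algebra_simps)
    then have "q ^ (4 * i) * (q ^ ((4 * i + 1) * (4 * (d + j) + 1)) * q ^ (4 * d))
      = q ^ (4 * j + 1) * Q ^ (2 * i * j) * Q ^ (d * (2 * i + 1) + i)"
      by (simp only: power_mult[of q 8, symmetric] power_add[symmetric])
    moreover have "f (d + j)
      = q ^ (4 * i) * (q ^ ((4 * i + 1) * (4 * (d + j) + 1)) * q ^ (4 * d)) * w d"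
      using assms by (simp add: f_def matX_def matA_def qfrac_w)
    ultimately show ?thesis
      by (simp only: mult.assoc)
  qed
  have "adic_sums f ((\<Sum>m<j. f m) + q ^ (4 * j + 1) * Q ^ (2 * i * j) * U i)"
    by (rule adic_sums_unshift[OF f_dvd], unfold inf) (intro adic_sums_mult adic_sums_U)
  moreover have "adic_sums f (q ^ (4 * i) * matmul matA matX i j)"
    unfolding f_def matmul_def
    by (intro adic_sums_mult adic_sums_suminf dvd)
  ultimately have "q ^ (4 * i) * matmul matA matX i j
      = (\<Sum>m<j. f m) + q ^ (4 * j + 1) * Q ^ (2 * i * j) * U i"
    using adic_sums_imp_suminf by metis
  also have "(\<Sum>m<j. f m) = (\<Sum>d<j. f (j - Suc d))"
    by (rule sum.nat_diff_reindex[symmetric])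
  also have "\<dots> = - (q ^ (4 * j + 1) * finite_part j i)"
    unfolding finite_part_def sum_distrib_left sum_negf[symmetric]
    by (intro sum.cong refl fin) simp
  finally show ?thesis
    by (simp add: algebra_simps)
qed

section \<open>The column \<open>j = 0\<close>\<close>

definition r :: "nat \<Rightarrow> qseries" where
  "r n = qfrac (qpoch (q ^ 8) (q ^ 16) n) (qpoch (q ^ 16) (q ^ 16) n)"

lemma r_Suc: "r (Suc n) * (1 - (q ^ 16) ^ Suc n) = r n * (1 - Q * (q ^ 16) ^ n)"
proof -
  let ?P = "qpoch (q ^ 16) (q ^ 16) :: nat \<Rightarrow> qseries"
  have r: "r n * ?P n = qpoch Q (q ^ 16) n" for n
    unfolding r_def by (rule qfrac_mult_cancel) (rule qpoch_nth_0)
  have "?P n * (r (Suc n) * (1 - (q ^ 16) ^ Suc n)) = r (Suc n) * ?P (Suc n)"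
    by (simp add: qpoch_def algebra_simps)
  also have "\<dots> = qpoch Q (q ^ 16) n * (1 - Q * (q ^ 16) ^ n)"
    unfolding r by (simp add: qpoch_def)
  also have "\<dots> = ?P n * (r n * (1 - Q * (q ^ 16) ^ n))"
    unfolding r[symmetric] by (simp only: mult_ac)
  finally show ?thesis
    using qpoch_nth_0[of n] by (metis fps_zero_nth mult_left_cancel zero_neq_one)
qed

text \<open>The hypothesis is the recurrence of the q-binomial coefficients
  \<open>(a;p)_n / (p;p)_n\<close>. Without the last term, which is the truncation error, this is
  the functional equation \<open>(1 - z) F(z) = (1 - a z) F(p z)\<close>.\<close>

lemma truncated_q_binomial:
  fixes a p z :: "'a::comm_ring_1" and c :: "nat \<Rightarrow> 'a"
  assumes "\<And>n. c (Suc n) * (1 - p ^ Suc n) = c n * (1 - a * p ^ n)"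
  shows "(1 - z) * (\<Sum>m<N. c m * z ^ m)
    = (1 - a * z) * (\<Sum>m<N. c m * (p * z) ^ m) - z ^ N * (c N * (1 - p ^ N))"
proof (induction N)
  case (Suc N)
  show ?case
    unfolding assms sum.lessThan_Suc distrib_left Suc.IH
    by (simp add: algebra_simps power_mult_distrib)
qed simp

text \<open>For \<open>a = Q\<close> and \<open>p = q ^ 16\<close>, multiplying
  \<open>z = Q ^ (2 * i + 1)\<close> by \<open>p\<close> moves from row \<open>i\<close> to row
  \<open>Suc i\<close>.\<close>

lemma r_truncated:
  "(1 - Q ^ (2 * i + 1)) * (\<Sum>m<N. r m * (Q ^ (2 * i + 1)) ^ m)
    = (1 - Q ^ (2 * i + 2)) * (\<Sum>m<N. r m * (Q ^ (2 * Suc i + 1)) ^ m)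
      - (Q ^ (2 * i + 1)) ^ N * (r N * (1 - (q ^ 16) ^ N))"
proof -
  have "Q * Q ^ (2 * i + 1) = Q ^ (2 * i + 2)" "q ^ 16 * Q ^ (2 * i + 1) = Q ^ (2 * Suc i + 1)"
    by (simp_all add: power_mult[symmetric] power_add[symmetric] algebra_simps)
  then show ?thesis
    using truncated_q_binomial[of r "q ^ 16" Q "Q ^ (2 * i + 1)" N] r_Suc by metis
qed

text \<open>Shanks' finite form of Gauss's identity for the sum of all \<open>Q ^ (s * (s + 1) div 2)\<close>.\<close>
lemma truncated_gauss_identity:
  "r n * (\<Sum>s<2 * n. q ^ ((2 * s + 1)\<^sup>2)) = q * (\<Sum>s<n. r s * (Q ^ (2 * n + 1)) ^ s)"
proof (induction n)
  case (Suc n)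
  define z where "z = Q ^ (2 * n + 1)"
  define T where "T = (\<Sum>s<2 * n. q ^ ((2 * s + 1)\<^sup>2))"
  define S where "S = (\<Sum>s<n. r s * z ^ s)"
  define S' where "S' = (\<Sum>s<Suc n. r s * (Q ^ (2 * Suc n + 1)) ^ s)"
  have IH: "r n * T = q * S"
    using Suc.IH by (simp add: T_def S_def z_def)
  have p: "(q ^ 16) ^ Suc n = Q ^ (2 * n + 2)" "Q * (q ^ 16) ^ n = z"
    by (simp_all add: z_def power_mult[symmetric] power_add[symmetric] del: power_Suc)
  have r: "r (Suc n) * (1 - Q ^ (2 * n + 2)) = r n * (1 - z)"
    using r_Suc[of n] unfolding p .
  \<comment> \<open>The two new odd squares are \<open>(4n+1)^2 = 1 + 8(2n+1)n\<close> and
    \<open>(4n+3)^2 = 1 + 8(2n+1)(n+1)\<close>.\<close>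
  have e: "q ^ ((2 * (2 * n) + 1)\<^sup>2) = q * z ^ n" "q ^ ((2 * Suc (2 * n) + 1)\<^sup>2) = q * z ^ Suc n"
    unfolding z_def power_mult[symmetric] power_Suc[symmetric]
    by (rule arg_cong[of _ _ "power q"], simp add: power2_eq_square algebra_simps)+
  have "(1 - z) * (S + r n * z ^ n) = (1 - Q ^ (2 * n + 2)) * S' - z ^ Suc n * (r n * (1 - z))"
    using r_truncated[of n "Suc n"] unfolding p r S'_def S_def z_def[symmetric] by simp
  \<comment> \<open>The truncation error combines with the new term of the sum into the factor
    \<open>1 + z\<close>, which matches the two new squares.\<close>
  then have S': "(1 - Q ^ (2 * n + 2)) * S' = (1 - z) * (S + r n * z ^ n * (1 + z))"
    by (simp add: algebra_simps)
  have "(1 - Q ^ (2 * n + 2)) * (r (Suc n) * (\<Sum>s<2 * Suc n. q ^ ((2 * s + 1)\<^sup>2)))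
    = (r (Suc n) * (1 - Q ^ (2 * n + 2))) * (T + q * z ^ n + q * z ^ Suc n)"
    using e by (simp add: T_def)
  also have "\<dots> = (1 - z) * (r n * T + q * r n * z ^ n * (1 + z))"
    unfolding r by (simp add: algebra_simps)
  also have "\<dots> = (1 - Q ^ (2 * n + 2)) * (q * S')"
    unfolding IH mult.left_commute[of _ q S'] S' by (simp add: algebra_simps)
  finally have "(1 - Q ^ (2 * n + 2)) * (r (Suc n) * (\<Sum>s<2 * Suc n. q ^ ((2 * s + 1)\<^sup>2)))
    = (1 - Q ^ (2 * n + 2)) * (q * S')" .
  moreover have "1 - Q ^ (2 * n + 2) \<noteq> 0"
  proof
    assume "1 - Q ^ (2 * n + 2) = 0"
    then have "fps_nth (1 - Q ^ (2 * n + 2)) 0 = 0"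
      by simp
    then show False
      by (simp flip: power_mult)
  qed
  ultimately show ?case
    unfolding S'_def by (rule iffD1[OF mult_left_cancel, rotated])
qed simp

section \<open>The series \<open>G\<close> and the entry \<open>matB 0 0\<close>\<close>

definition G :: "nat \<Rightarrow> qseries" where
  "G i = (\<Sum>m. r m * (Q ^ (2 * i + 1)) ^ m)"

lemma X_power_dvd_z: "q ^ m dvd (Q ^ (2 * i + 1)) ^ m"
  unfolding power_mult[symmetric] by (rule le_imp_power_dvd) simp

lemma adic_sums_G: "adic_sums (\<lambda>m. r m * (Q ^ (2 * i + 1)) ^ m) (G i)"
  unfolding G_def by (intro adic_sums_suminf dvd_mult X_power_dvd_z)

text \<open>Limit of \<open>r_truncated\<close>: its error term is divisible by
  \<open>q ^ N\<close>.\<close>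

lemma G_Suc: "(1 - Q ^ (2 * i + 1)) * G i = (1 - Q ^ (2 * i + 2)) * G (Suc i)"
proof -
  let ?S = "\<lambda>i N. \<Sum>m<N. r m * (Q ^ (2 * i + 1)) ^ m"
  have "q ^ N dvd (1 - Q ^ (2 * i + 1)) * G i - (1 - Q ^ (2 * i + 2)) * G (Suc i)" for N
  proof -
    have h: "q ^ N dvd G i - ?S i N" for i
      using adic_sums_G unfolding adic_sums_def by blast
    have "q ^ N dvd (1 - Q ^ (2 * i + 1)) * (G i - ?S i N)
        - (1 - Q ^ (2 * i + 2)) * (G (Suc i) - ?S (Suc i) N)
        - (Q ^ (2 * i + 1)) ^ N * (r N * (1 - (q ^ 16) ^ N))"
      by (rule dvd_diff[OF dvd_diff[OF dvd_mult[OF h] dvd_mult[OF h]] dvd_mult2[OF X_power_dvd_z]])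
    also have "\<dots> = (1 - Q ^ (2 * i + 1)) * G i - (1 - Q ^ (2 * i + 2)) * G (Suc i)"
      using r_truncated[of i N] by (simp only: right_diff_distrib) (simp add: algebra_simps)
    finally show ?thesis .
  qed
  then show ?thesis
    using eq_0_if_X_powers_dvd by (metis eq_iff_diff_eq_0)
qed

lemma r_mult_matB_00: "r i * matB 0 0 = q * G i"
proof -
  define D where "D i = r i * matB 0 0 - q * G i" for i
  have D_step: "D i = w i * (1 - Q ^ (2 * i + 2)) * D (Suc i)" for i
  proof -
    have r: "r i * (1 - Q ^ (2 * i + 1)) = r (Suc i) * (1 - Q ^ (2 * i + 2))"
    proof -
      have "(q ^ 16) ^ Suc i = Q ^ (2 * i + 2)" "Q * (q ^ 16) ^ i = Q ^ (2 * i + 1)"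
        by (simp_all add: power_mult[symmetric] power_add[symmetric] del: power_Suc)
      then show ?thesis
        using r_Suc[of i] by metis
    qed
    have "(1 - Q ^ (2 * i + 1)) * D i = (r i * (1 - Q ^ (2 * i + 1))) * matB 0 0
        - q * ((1 - Q ^ (2 * i + 1)) * G i)"
      unfolding D_def by (simp only: algebra_simps)
    also have "\<dots> = (1 - Q ^ (2 * i + 2)) * D (Suc i)"
      unfolding D_def r G_Suc by (simp only: algebra_simps)
    finally have "w i * (1 - Q ^ (2 * i + 1)) * D i = w i * (1 - Q ^ (2 * i + 2)) * D (Suc i)"
      by (simp only: mult.assoc)
    then show ?thesis
      unfolding w_mult by simp
  qed
  \<comment> \<open>At row \<open>n\<close> the truncated sums cancel by
    \<open>truncated_gauss_identity\<close>, so only the two tails remain.\<close>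
  have base: "q ^ n dvd D n" for n
  proof -
    let ?T = "\<Sum>s<2 * n. q ^ ((2 * s + 1)\<^sup>2)"
    let ?S = "\<Sum>s<n. r s * (Q ^ (2 * n + 1)) ^ s"
    have "q ^ m dvd q ^ ((2 * m + 1)\<^sup>2)" for m
      by (rule le_imp_power_dvd) (simp add: power2_eq_square)
    then have "adic_sums (\<lambda>s. q ^ ((2 * s + 1)\<^sup>2)) (matB 0 0)"
      by (simp add: matB_def adic_sums_suminf)
    then have "q ^ (2 * n) dvd matB 0 0 - ?T"
      unfolding adic_sums_def by blast
    then have "q ^ n dvd matB 0 0 - ?T"
      by (rule power_le_dvd) simp
    moreover have "q ^ n dvd G n - ?S"
      using adic_sums_G unfolding adic_sums_def by blast
    ultimately have "q ^ n dvd r n * (matB 0 0 - ?T) - q * (G n - ?S)"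
      by (rule dvd_diff[OF dvd_mult dvd_mult])
    also have "\<dots> = D n"
      using truncated_gauss_identity[of n] unfolding D_def
      by (simp only: right_diff_distrib) (simp add: algebra_simps)
    finally show ?thesis .
  qed
  \<comment> \<open>For fixed \<open>n\<close>, \<open>D_step\<close> carries the divisibility from
    row \<open>n\<close> down to row \<open>i\<close>.\<close>
  have "q ^ n dvd D i" if "i \<le> n" for i n
    using that
  proof (induction rule: inc_induct)
    case (step i)
    then show ?case
      using D_step by (metis dvd_mult)
  qed (rule base)
  \<comment> \<open>If \<open>n\<close> is at most \<open>i\<close>, then \<open>q ^ n\<close>
    divides \<open>q ^ i\<close>, which divides \<open>D i\<close>.\<close>
  then have "q ^ n dvd D i" for n
    by (metis le_imp_power_dvd dvd_trans nat_le_linear)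
  then have "D i = 0"
    by (rule eq_0_if_X_powers_dvd)
  then show ?thesis
    by (simp add: D_def)
qed

section \<open>Both products in column 0, and the conclusion\<close>

lemma XB_0: "matmul matX matB i 0 = q ^ (4 * i) * (r i * matB 0 0)"
proof -
  have "matmul matX matB i 0 = (\<Sum>m\<in>{0}. matX i m * matB m 0)"
    unfolding matmul_def by (rule suminf_finite) (auto simp: matB_def)
  then show ?thesis
    by (simp add: matX_def r_def)
qed

lemma AX_0: "matmul matA matX i 0 = q ^ (4 * i) * (q * G i)"
proof -
  have "matA i m * matX m 0 = q ^ (4 * i) * (q * (r m * (Q ^ (2 * i + 1)) ^ m))" for m
  proof -
    have "(4 * i + 1) * (4 * m + 1) + 4 * m = 4 * i + 1 + 8 * ((2 * i + 1) * m)"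
      by (simp add: algebra_simps)
    then have "q ^ ((4 * i + 1) * (4 * m + 1)) * q ^ (4 * m) = q ^ (4 * i) * q * (Q ^ (2 * i + 1)) ^ m"
      by (simp only: power_add[symmetric] power_mult[symmetric] power_Suc2[symmetric])
        (simp add: algebra_simps del: power_Suc)
    then show ?thesis
      by (simp add: matA_def matX_def r_def[symmetric] mult_ac)
  qed
  moreover have "adic_sums (\<lambda>m. q ^ (4 * i) * (q * (r m * (Q ^ (2 * i + 1)) ^ m)))
      (q ^ (4 * i) * (q * G i))"
    by (intro adic_sums_mult adic_sums_G)
  ultimately show ?thesis
    unfolding matmul_def by (simp add: adic_sums_imp_suminf)
qed

theorem mainTheorem2:
  shows "matmul matX matB = matmul matA matX"
proof (intro ext)
  fix i j
  show "matmul matX matB i j = matmul matA matX i j"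
  proof (cases "j = 0")
    case True
    then show ?thesis
      by (simp only: XB_0 AX_0 r_mult_matB_00)
  next
    case False
    then have "q ^ (4 * i) * matmul matX matB i j = q ^ (4 * i) * matmul matA matX i j"
      by (simp only: XB_pos AX_pos finite_part_commute neq0_conv)
    then show ?thesis
      by simp
  qed
qed

end
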